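(* Let $L_p(S;X)$ be a uniformly convex and uniformly smooth Bochner space with $1<p<\infty$. Let $\{A_n\in\mathcal A: n\in M\}$ be a strong partition of $S$. For any $f\in L_p(S;X)$ with $f\neq\theta$, $$J_pf=\frac{1}{\|f\|_{L_p(S;X)}^{p-2}}\sum_{n\in M}\|f_{A_n}\|_{L_p(A_n;X)}^{p-2}\,J_pf_{A_n}.$$
   Context: Let $(S,\mathcal A,\mu)$ be a positive measure space, $X$ a real uniformly convex and uniformly smooth Banach space with dual $X^*$, and $1<p,q<\infty$ with $\frac1p+\frac1q=1$. $L_p(S;X)$ is the Bochner space of ($\mu$-equivalence classes of) strongly measurable $f:S\to X$ with $\|f\|_{L_p(S;X)}=\left(\int_S\|f(s)\|_X^p\,d\mu(s)\right)^{1/p}<\infty$; it is a uniformly convex and uniformly smooth Banach space whose dual is identified with $L_q(S;X^* )$ via $\langle\varphi,f\rangle_{L_p}=\int_S\langle\varphi(s),f(s)\rangle\,d\mu(s)$. The normalized duality mapping $J_p:L_p(S;X)\to L_q(S;X^* )$ is the single-valued map characterized by $\langle J_pf,f\rangle_{L_p}=\|J_pf\|_{L_q(S;X^* )}^2=\|f\|_{L_p(S;X)}^2$. For $A\in\mathcal A$ with $\mu(A)>0$, $L_p(A;X)=\{f\in L_p(S;X): f(s)=\theta\text{ for }\mu\text{-a.e. }s\in S\setminus A\}$ with the induced norm ($\theta$ denotes the zero vector), and for $f\in L_p(S;X)$, $f_A$ is defined by $f_A(s)=f(s)$ for $s\in A$ and $f_A(s)=\theta$ for $s\notin A$. A family $\{A_n\in\mathcal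 A:n\in M\}$, with $M$ a nonempty subset of the set of all positive integers, is called a strong partition of $S$ if $\mu(A_n)>0$ for every $n\in M$, $A_n\cap A_m=\emptyset$ for $n\ne m$, and $\bigcup_{n\in M}A_n=S$. *)

theory Defs
  imports "HOL-Analysis.Analysis"
begin

definition uniformly_convex :: "'a::real_normed_vector itself \<Rightarrow> bool" where
  "uniformly_convex _ \<longleftrightarrow>
    (\<forall>\<epsilon>>0. \<exists>\<delta>>0. \<forall>x y :: 'a.
       norm x = 1 \<longrightarrow> norm y = 1 \<longrightarrow> norm (x - y) \<ge> \<epsilon> \<longrightarrow> norm ((1/2) *\<^sub>R (x + y)) \<le> 1 - \<delta>)"

definition uniformly_smooth :: "'a::real_normed_vector itself \<Rightarrow> bool" where
  "uniformly_smooth _ \<longleftrightarrow>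
    (\<forall>\<epsilon>>0. \<exists>\<delta>>0. \<forall>x y :: 'a.
       norm x = 1 \<longrightarrow> norm y \<le> \<delta> \<longrightarrow> norm (x + y) + norm (x - y) \<le> 2 + \<epsilon> * norm y)"

text \<open>Elements of Bochner spaces are represented by functions, and equality of elements is
  equality almost everywhere. The limit below is required at every point of the space rather than
  almost everywhere: each equivalence class has such a representative, and its norm is then
  measurable even if the measure is not complete. The value space need not be separable, so
  Borel measurability would not be enough.\<close>

definition strongly_measurable :: "'s measure \<Rightarrow> ('s \<Rightarrow> 'a::real_normed_vector) \<Rightarrow> bool" where
  "strongly_measurable S f \<longleftrightarrow>
    (\<exists>F. (\<forall>i. simple_function S (F i)) \<and> (\<forall>s\<in>space S. (\<lambda>i::nat. F i s) \<longlonglongrightarrow> f s))"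

definition Lp :: "'s measure \<Rightarrow> real \<Rightarrow> ('s \<Rightarrow> 'a::real_normed_vector) set" where
  "Lp S p = {f. strongly_measurable S f \<and> integrable S (\<lambda>s. norm (f s) powr p)}"

text \<open>Only meaningful on \<^term>\<open>Lp S p\<close>, since the integral of a non-integrable function is 0.\<close>

definition Lp_norm :: "'s measure \<Rightarrow> real \<Rightarrow> ('s \<Rightarrow> 'a::real_normed_vector) \<Rightarrow> real" where
  "Lp_norm S p f = (\<integral>s. norm (f s) powr p \<partial>S) powr (1 / p)"

definition Lp_pairing ::
    "'s measure \<Rightarrow> ('s \<Rightarrow> ('a::real_normed_vector \<Rightarrow>\<^sub>L real)) \<Rightarrow> ('s \<Rightarrow> 'a) \<Rightarrow> real" where
  "Lp_pairing S g f = (\<integral>s. blinfun_apply (g s) (f s) \<partial>S)"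

text \<open>The normalized duality mapping, with \<open>q\<close> the conjugate exponent of \<open>p\<close>. The dual element
  is unique only up to null sets, so a representative is chosen.\<close>

definition duality_map ::
    "'s measure \<Rightarrow> real \<Rightarrow> real \<Rightarrow> ('s \<Rightarrow> 'a::real_normed_vector) \<Rightarrow> 's \<Rightarrow> ('a \<Rightarrow>\<^sub>L real)" where
  "duality_map S p q f =
    (SOME g. g \<in> Lp S q \<and>
       Lp_pairing S g f = (Lp_norm S q g)\<^sup>2 \<and> (Lp_norm S q g)\<^sup>2 = (Lp_norm S p f)\<^sup>2)"

definition cut_off :: "'s set \<Rightarrow> ('s \<Rightarrow> 'a::zero) \<Rightarrow> 's \<Rightarrow> 'a" where
  "cut_off A f = (\<lambda>s. if s \<in> A then f s else 0)"

definition strong_partition :: "'s measure \<Rightarrow> nat set \<Rightarrow> (nat \<Rightarrow> 's set) \<Rightarrow> bool" where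
  "strong_partition S M A \<longleftrightarrow>
    M \<noteq> {} \<and> M \<subseteq> {1..} \<and> (\<forall>n\<in>M. A n \<in> sets S \<and> emeasure S (A n) > 0) \<and>
    disjoint_family_on A M \<and> (\<Union>n\<in>M. A n) = space S"

text \<open>The analogue of \<^const>\<open>has_sum\<close> for convergence in the norm of \<open>L\<^sub>p\<close>.\<close>

definition Lp_has_sum ::
    "'s measure \<Rightarrow> real \<Rightarrow> ('i \<Rightarrow> 's \<Rightarrow> 'a::real_normed_vector) \<Rightarrow> 'i set \<Rightarrow> ('s \<Rightarrow> 'a) \<Rightarrow> bool" where
  "Lp_has_sum S p F I h \<longleftrightarrow>
    (\<forall>i\<in>I. F i \<in> Lp S p) \<and> h \<in> Lp S p \<and>
    ((\<lambda>J. Lp_norm S p (\<lambda>s. (\<Sum>i\<in>J. F i s) - h s)) \<longlongrightarrow> 0) (finite_subsets_at_top I)"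

end

theory Submission
  imports Defs
begin

text \<open>Uniform smoothness gives every unit vector \<open>u\<close> a unique norming functional, which depends
  continuously on \<open>u\<close>. Let \<open>\<Phi> x\<close> be the norming functional of \<open>x / \<parallel>x\<parallel>\<close> multiplied by
  \<open>\<parallel>x\<parallel> powr (p - 1)\<close>. The equality cases of Young's inequality and of
  \<open>\<langle>g s, f s\<rangle> \<le> \<parallel>g s\<parallel> \<parallel>f s\<parallel>\<close> show that \<open>\<parallel>f\<parallel> powr (p - 2) *\<^sub>R J\<^sub>p f\<close> is
  \<open>\<Phi> \<circ> f\<close> almost everywhere. This is a pointwise expression with \<open>\<Phi> 0 = 0\<close>, so cutting off
  \<open>f\<close> cuts off \<open>\<Phi> \<circ> f\<close>, and the \<open>q\<close>-th power of the norm of a remainder of the series is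
  the integral of \<open>\<parallel>f s\<parallel> powr p\<close> over the remaining cells.\<close>

section \<open>Norming functionals of unit vectors and the pointwise duality map\<close>

lemma uniformly_smoothE:
  assumes "uniformly_smooth TYPE('a::real_normed_vector)" "0 < \<epsilon>"
  obtains \<delta> where "0 < \<delta>" "\<And>x y :: 'a. norm x = 1 \<Longrightarrow> norm y \<le> \<delta> \<Longrightarrow>
    norm (x + y) + norm (x - y) \<le> 2 + \<epsilon> * norm y"
proof -
  obtain \<delta> where "0 < \<delta>" "\<forall>x y :: 'a. norm x = 1 \<longrightarrow> norm y \<le> \<delta> \<longrightarrow>
      norm (x + y) + norm (x - y) \<le> 2 + \<epsilon> * norm y"
    using assms unfolding uniformly_smooth_def by meson
  then show ?thesis using that[of \<delta>] by simp
qed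

text \<open>No Hahn-Banach theorem is needed: the one-sided directional derivative of the norm at \<open>x\<close>
  is sublinear, and smoothness makes it odd, hence linear.\<close>

lemma norming_functional_exists:
  fixes x :: "'a::real_normed_vector"
  assumes smooth: "uniformly_smooth TYPE('a)" and x: "norm x = 1"
  shows "\<exists>g :: 'a \<Rightarrow>\<^sub>L real. norm g \<le> 1 \<and> blinfun_apply g x = 1"
proof -
  define D where "D y t = (norm (x + t *\<^sub>R y) - 1) / t" for y t
  \<comment> \<open>\<open>D y t\<close> increases with \<open>t\<close> by convexity of the norm,
    so this infimum is the right derivative of the norm at \<open>x\<close> in direction
    \<open>y\<close>; taking an infimum avoids handling a limit.\<close>
  define P where "P y = (INF t\<in>{0<..}. D y t)" for y
  have D_ge: "- norm y \<le> D y t" if "0 < t" for y t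
  proof -
    have "1 \<le> norm (x + t *\<^sub>R y) + norm (t *\<^sub>R y)"
      using norm_triangle_ineq4[of "x + t *\<^sub>R y" "t *\<^sub>R y"] x by simp
    then show ?thesis using that by (simp add: D_def field_simps)
  qed
  have D_le: "D y t \<le> norm y" if "0 < t" for y t
  proof -
    have "norm (x + t *\<^sub>R y) \<le> 1 + t * norm y"
      using norm_triangle_ineq[of x "t *\<^sub>R y"] x that by simp
    then show ?thesis using that by (simp add: D_def field_simps)
  qed
  have bdd: "bdd_below (D y ` {0<..})" for y
    by (rule bdd_belowI2[where m = "- norm y"]) (use D_ge in auto)
  have P_le: "P y \<le> D y t" if "0 < t" for y t
    unfolding P_def by (rule cINF_lower[OF bdd]) (use that in auto)
  have P_ge: "m \<le> P y" if "\<And>t. 0 < t \<Longrightarrow> m \<le> D y t" for m y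
    unfolding P_def by (rule cINF_greatest) (use that in auto)
  have D_mono: "D y s \<le> D y t" if "0 < s" "s \<le> t" for y s t
  proof -
    have eq: "x + s *\<^sub>R y = (1 - s / t) *\<^sub>R x + (s / t) *\<^sub>R (x + t *\<^sub>R y)"
      using that by (simp add: algebra_simps)
    have "norm (x + s *\<^sub>R y) \<le> (1 - s / t) + (s / t) * norm (x + t *\<^sub>R y)"
      unfolding eq using that x by (intro norm_triangle_le) simp
    then have "t * norm (x + s *\<^sub>R y) \<le> t * ((1 - s / t) + (s / t) * norm (x + t *\<^sub>R y))"
      using that by (intro mult_left_mono) auto
    also have "\<dots> = t - s + s * norm (x + t *\<^sub>R y)"
      using that by (simp add: field_simps)
    finally show ?thesis using that by (simp add: D_def field_simps)
  qed
  have D_add: "D (y + z) (r / 2) \<le> D y r + D z r" if "0 < r" for y z r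
  proof -
    \<comment> \<open>The point reached by \<open>y + z\<close> at parameter \<open>r / 2\<close> is
      the midpoint of those reached by \<open>y\<close> and \<open>z\<close> at \<open>r\<close>;
      hence the halved parameter.\<close>
    have eq: "x + (r / 2) *\<^sub>R (y + z) = (1/2) *\<^sub>R (x + r *\<^sub>R y) + (1/2) *\<^sub>R (x + r *\<^sub>R z)"
      by (simp add: algebra_simps flip: scaleR_left.add)
    have "norm (x + (r / 2) *\<^sub>R (y + z)) \<le> (1/2) * norm (x + r *\<^sub>R y) + (1/2) * norm (x + r *\<^sub>R z)"
      unfolding eq by (intro norm_triangle_le) simp
    moreover have "(c - 1) / (r / 2) \<le> (a - 1) / r + (b - 1) / r" if "c \<le> (1/2) * a + (1/2) * b"
      for a b c :: real
      using mult_right_mono[OF that, of r] \<open>0 < r\<close> by (simp add: field_simps)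
    ultimately show ?thesis by (simp add: D_def)
  qed
  have P_add_le: "P (y + z) \<le> P y + P z" for y z
  proof -
    have *: "P (y + z) \<le> D y s + D z t" if "0 < s" "0 < t" for s t
    proof -
      have "P (y + z) \<le> D (y + z) (min s t / 2)" using that by (intro P_le) auto
      also have "\<dots> \<le> D y (min s t) + D z (min s t)" using that by (intro D_add) auto
      also have "\<dots> \<le> D y s + D z t" using that by (intro add_mono D_mono) auto
      finally show ?thesis .
    qed
    have "P (y + z) - D z t \<le> P y" if "0 < t" for t
      by (rule P_ge) (use *[OF _ that] in \<open>force simp: algebra_simps\<close>)
    then have "P (y + z) - P y \<le> P z"
      by (intro P_ge) (force simp: algebra_simps)
    then show ?thesis by simp
  qed
  have P0: "P 0 = 0"
    using P_le[of 1 0] P_ge[of 0 0] x by (simp add: D_def)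
  have P_minus: "P (- y) = - P y" for y
  proof (cases "y = 0")
    case False
    have "P y + P (- y) \<le> \<epsilon>" if "0 < \<epsilon>" for \<epsilon>
    proof -
      \<comment> \<open>Smoothness is applied to \<open>t *\<^sub>R y\<close>; the divisor
        \<open>norm y\<close> makes its error term exactly \<open>\<epsilon> * t\<close>, so the sum
        of the two difference quotients is at most \<open>\<epsilon>\<close>.\<close>
      obtain \<delta> where \<delta>: "0 < \<delta>"
        "\<And>u v :: 'a. norm u = 1 \<Longrightarrow> norm v \<le> \<delta> \<Longrightarrow>
           norm (u + v) + norm (u - v) \<le> 2 + (\<epsilon> / norm y) * norm v"
        using uniformly_smoothE[OF smooth, of "\<epsilon> / norm y"] False \<open>0 < \<epsilon>\<close> by auto
      define t where "t = \<delta> / norm y"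
      have t: "0 < t" "norm (t *\<^sub>R y) = \<delta>" using False \<delta>(1) by (auto simp: t_def)
      have "norm (x + t *\<^sub>R y) + norm (x - t *\<^sub>R y) \<le> 2 + \<epsilon> * t"
        using \<delta>(2)[OF x, of "t *\<^sub>R y"] t False by (auto simp: t_def field_simps)
      then have "(norm (x + t *\<^sub>R y) + norm (x - t *\<^sub>R y) - 2) / t \<le> \<epsilon>"
        using t(1) by (simp add: divide_le_eq)
      then have "D y t + D (- y) t \<le> \<epsilon>" by (simp add: D_def add_divide_distrib diff_divide_distrib)
      then show ?thesis using P_le[OF t(1), of y] P_le[OF t(1), of "- y"] by simp
    qed
    then have "P y + P (- y) \<le> 0" by (rule dense_ge)
    moreover have "0 \<le> P y + P (- y)" using P_add_le[of y "- y"] P0 by simp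
    ultimately show ?thesis by simp
  qed (simp add: P0)
  have P_add: "P (y + z) = P y + P z" for y z
    \<comment> \<open>Subadditivity at \<open>- y\<close> and \<open>- z\<close>, together with
      oddness, is superadditivity at \<open>y\<close> and \<open>z\<close>.\<close>
    using P_add_le[of y z] P_add_le[of "- y" "- z"] P_minus[of "y + z"] P_minus[of y] P_minus[of z]
    by (simp add: algebra_simps)
  have P_scale_le: "P (c *\<^sub>R y) \<le> c * P y" if "0 < c" for c y
  proof -
    have "P (c *\<^sub>R y) / c \<le> D y s" if "0 < s" for s
      using P_le[of "s / c" "c *\<^sub>R y"] \<open>0 < c\<close> that by (simp add: D_def field_simps)
    then have "P (c *\<^sub>R y) / c \<le> P y" by (rule P_ge)
    then show ?thesis using that by (simp add: field_simps)
  qed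
  have P_scale_pos: "P (c *\<^sub>R y) = c * P y" if "0 < c" for c y
    using P_scale_le[OF that, of y] P_scale_le[of "1 / c" "c *\<^sub>R y"] that
    by (simp add: field_simps)
  have P_scale: "P (c *\<^sub>R y) = c * P y" for c y
  proof -
    consider "0 < c" | "c = 0" | "0 < - c" by linarith
    then show ?thesis
      using P_scale_pos[of c y] P_scale_pos[of "- c" y] P_minus[of "c *\<^sub>R y"] P0 by cases auto
  qed
  have P_le_norm: "P y \<le> norm y" for y
    using P_le[of 1 y] D_le[of 1 y] by simp
  have P_abs: "\<bar>P y\<bar> \<le> norm y" for y
    using P_le_norm[of y] P_le_norm[of "- y"] P_minus[of y] by simp
  have lin: "bounded_linear P"
    by (rule bounded_linear_intro[where K = 1]) (use P_add P_scale P_abs in auto)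
  have Dx: "D x t = 1" if "0 < t" for t
  proof -
    have "x + t *\<^sub>R x = (1 + t) *\<^sub>R x" by (simp add: algebra_simps)
    then show ?thesis using that x by (simp add: D_def)
  qed
  have "P x = 1"
    using P_le[of 1 x] P_ge[of 1 x] Dx by force
  moreover have "norm (Blinfun P) \<le> 1"
    by (rule norm_blinfun_bound) (use P_abs in \<open>auto simp: bounded_linear_Blinfun_apply[OF lin]\<close>)
  ultimately show ?thesis
    by (intro exI[of _ "Blinfun P"]) (simp add: bounded_linear_Blinfun_apply[OF lin])
qed

text \<open>Adding the bounds for \<open>g (x + v)\<close> and \<open>h (x - v)\<close> leaves
  \<open>(g - h) v\<close> against the smoothness error, up to the cost of replacing
  \<open>x'\<close> by \<open>x\<close> in \<open>h\<close>. Taking \<open>x' = x\<close> gives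
  uniqueness of norming functionals; letting \<open>x'\<close> tend to \<open>x\<close> gives
  continuity.\<close>

lemma norming_functionals_close:
  fixes x x' :: "'a::real_normed_vector" and g h :: "'a \<Rightarrow>\<^sub>L real"
  assumes \<delta>: "0 < \<delta>" "\<And>v. norm v \<le> \<delta> \<Longrightarrow> norm (x + v) + norm (x - v) \<le> 2 + \<epsilon> * norm v"
    and \<epsilon>: "0 \<le> \<epsilon>" and g: "norm g \<le> 1" "g x = 1" and h: "norm h \<le> 1" "h x' = 1"
  shows "norm (g - h) \<le> \<epsilon> + norm (x - x') / \<delta>"
proof (rule norm_blinfun_bound)
  show "0 \<le> \<epsilon> + norm (x - x') / \<delta>" using \<delta>(1) \<epsilon> by simp
  have le: "blinfun_apply k z \<le> norm z" if "norm k \<le> 1" for k :: "'a \<Rightarrow>\<^sub>L real" and z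
    using norm_blinfun[of k z] mult_right_mono[OF that norm_ge_zero[of z]] by simp
  have upper: "(g - h) z \<le> (\<epsilon> + norm (x - x') / \<delta>) * norm z" if "z \<noteq> 0" for z
  proof -
    \<comment> \<open>\<open>z\<close> is rescaled to length \<open>\<delta>\<close>, the largest
      length for which the smoothness bound is available.\<close>
    define v where "v = (\<delta> / norm z) *\<^sub>R z"
    have v: "norm v = \<delta>" using that \<delta>(1) by (simp add: v_def)
    have "g (x + v) + h (x - v) \<le> 2 + \<epsilon> * \<delta>"
      using le[OF g(1), of "x + v"] le[OF h(1), of "x - v"] \<delta>(2)[of v] v by simp
    moreover have "h (x' - x) \<le> norm (x - x')"
      using le[OF h(1), of "x' - x"] by (simp add: norm_minus_commute)
    ultimately have "(g - h) v \<le> \<epsilon> * \<delta> + norm (x - x')"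
      using g(2) h(2) by (simp add: blinfun.bilinear_simps)
    moreover have "(g - h) v = \<delta> / norm z * (g - h) z"
      by (simp add: v_def blinfun.bilinear_simps)
    ultimately show ?thesis using that \<delta>(1) by (simp add: field_simps)
  qed
  show "norm ((g - h) z) \<le> (\<epsilon> + norm (x - x') / \<delta>) * norm z" for z
    using upper[of z] upper[of "- z"]
    by (cases "z = 0") (auto simp: blinfun.bilinear_simps abs_le_iff)
qed

lemma norming_functional_unique:
  fixes x :: "'a::real_normed_vector" and g h :: "'a \<Rightarrow>\<^sub>L real"
  assumes smooth: "uniformly_smooth TYPE('a)" and x: "norm x = 1"
    and g: "norm g \<le> 1" "g x = 1" and h: "norm h \<le> 1" "h x = 1"
  shows "g = h"
proof -
  have "norm (g - h) \<le> \<epsilon>" if "0 < \<epsilon>" for \<epsilon>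
  proof -
    obtain \<delta> where "0 < \<delta>"
      "\<And>v. norm v \<le> \<delta> \<Longrightarrow> norm (x + v) + norm (x - v) \<le> 2 + \<epsilon> * norm v"
      using uniformly_smoothE[OF smooth \<open>0 < \<epsilon>\<close>] x by metis
    then show ?thesis using norming_functionals_close[of \<delta> x \<epsilon> g h x] g h that by auto
  qed
  then have "norm (g - h) \<le> 0" by (rule dense_ge)
  then show ?thesis by simp
qed

text \<open>On the unit sphere of a uniformly smooth space the choice is forced, and the value is
  the derivative of the norm at \<open>u\<close>.\<close>

definition norming :: "'a::real_normed_vector \<Rightarrow> ('a \<Rightarrow>\<^sub>L real)" where
  "norming u = (SOME g. norm g \<le> 1 \<and> blinfun_apply g u = 1)"

lemma norming:
  fixes u :: "'a::real_normed_vector"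
  assumes "uniformly_smooth TYPE('a)" "norm u = 1"
  shows "norm (norming u) \<le> 1" "norming u u = 1"
  using someI_ex[OF norming_functional_exists[OF assms]] unfolding norming_def by auto

lemma norm_norming:
  fixes u :: "'a::real_normed_vector"
  assumes "uniformly_smooth TYPE('a)" "norm u = 1"
  shows "norm (norming u) = 1"
  using norm_blinfun[of "norming u" u] norming[OF assms] assms(2) by simp

lemma continuous_on_norming:
  assumes smooth: "uniformly_smooth TYPE('a::real_normed_vector)"
  shows "continuous_on (sphere (0::'a) 1) norming"
  unfolding continuous_on_iff
proof (intro ballI allI impI)
  fix x :: 'a and e :: real
  assume x: "x \<in> sphere 0 1" and e: "0 < e"
  obtain \<delta> where \<delta>: "0 < \<delta>" "\<And>x v :: 'a. norm x = 1 \<Longrightarrow> norm v \<le> \<delta> \<Longrightarrow>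
      norm (x + v) + norm (x - v) \<le> 2 + e / 2 * norm v"
    using uniformly_smoothE[OF smooth half_gt_zero[OF e]] by metis
  show "\<exists>d>0. \<forall>x'\<in>sphere 0 1. dist x' x < d \<longrightarrow> dist (norming x') (norming x) < e"
  proof (intro exI conjI ballI impI)
    show "0 < \<delta> * e / 2" using \<delta>(1) e by simp
    fix x' :: 'a assume x': "x' \<in> sphere 0 1" "dist x' x < \<delta> * e / 2"
    have "norm (norming x - norming x') \<le> e / 2 + norm (x - x') / \<delta>"
      using x x' e by (intro norming_functionals_close \<delta> norming smooth) auto
    also have "\<dots> < e" using x' \<delta>(1) by (simp add: dist_norm norm_minus_commute field_simps)
    finally show "dist (norming x') (norming x) < e" by (simp add: dist_norm norm_minus_commute)
  qed
qed

text \<open>The values of \<^const>\<open>norming\<close> outside the unit sphere are irrelevant; at \<open>0\<close> the factor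
  \<open>0 powr (p - 1) = 0\<close> removes the junk value.\<close>

definition power_duality :: "real \<Rightarrow> 'a::real_normed_vector \<Rightarrow> ('a \<Rightarrow>\<^sub>L real)" where
  "power_duality p x = norm x powr (p - 1) *\<^sub>R norming (sgn x)"

lemma norm_power_duality:
  fixes x :: "'a::real_normed_vector"
  assumes "uniformly_smooth TYPE('a)"
  shows "norm (power_duality p x) = norm x powr (p - 1)"
  by (cases "x = 0") (auto simp: power_duality_def norm_norming[OF assms] norm_sgn)

lemma power_duality_apply:
  fixes x :: "'a::real_normed_vector"
  assumes "uniformly_smooth TYPE('a)"
  shows "power_duality p x x = norm x powr p"
proof (cases "x = 0")
  case False
  then have "norming (sgn x) (sgn x) = 1"
    by (intro norming assms) (simp add: norm_sgn)
  then have "norming (sgn x) x = norm x"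
    using False by (simp add: sgn_div_norm blinfun.bilinear_simps field_simps)
  then show ?thesis
    using False by (simp add: power_duality_def blinfun.bilinear_simps powr_diff)
qed (simp add: power_duality_def)

text \<open>Divided by its norm, \<open>g\<close> becomes a norming functional of
  \<open>sgn x\<close>, and smoothness allows only one. The two hypotheses are the equality cases of
  Young's inequality and of the operator norm bound.\<close>

lemma power_duality_unique:
  fixes x :: "'a::real_normed_vector"
  assumes smooth: "uniformly_smooth TYPE('a)"
    and g: "norm g = norm x powr (p - 1)" "blinfun_apply g x = norm g * norm x"
  shows "g = power_duality p x"
proof (cases "x = 0")
  case False
  define c where "c = norm x powr (p - 1)"
  have c: "0 < c" using False by (simp add: c_def)
  have "g /\<^sub>R c = norming (sgn x)"
    by (rule norming_functional_unique[OF smooth, of "sgn x"])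
      (use g False c norming[OF smooth, of "sgn x"] in
        \<open>auto simp: norm_sgn sgn_div_norm c_def[symmetric] blinfun.bilinear_simps field_simps\<close>)
  then have "c *\<^sub>R (g /\<^sub>R c) = power_duality p x" by (simp add: power_duality_def c_def)
  then show ?thesis using c by simp
\<comment> \<open>For \<open>x = 0\<close> the norm condition reads \<open>norm g = 0\<close>, since
  \<open>0 powr r = 0\<close> for every \<open>r\<close>.\<close>
qed (use g in \<open>simp add: power_duality_def\<close>)

text \<open>Continuity carries approximating simple functions of \<open>f\<close> over to
  \<open>power_duality p\<close> composed with \<open>f\<close>, which makes the latter strongly
  measurable.\<close>

lemma continuous_on_power_duality:
  assumes smooth: "uniformly_smooth TYPE('a::real_normed_vector)" and p: "1 < p"
  shows "continuous_on UNIV (power_duality p :: 'a \<Rightarrow> _)"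
proof -
  have "continuous_on (- {0}) (power_duality p :: 'a \<Rightarrow> _)"
    unfolding power_duality_def
    by (intro continuous_intros continuous_on_compose2[OF continuous_on_norming[OF smooth]] continuous_on_sgn)
       (auto simp: norm_sgn split: if_splits)
  then have nz: "isCont (power_duality p) x" if "x \<noteq> 0" for x :: 'a
    using that by (simp add: continuous_on_eq_continuous_at open_Compl)
  \<comment> \<open>At 0 the factor \<open>norming (sgn x)\<close> need not converge, but it is
    bounded, and the other factor tends to 0 because \<open>p > 1\<close>.\<close>
  have "((\<lambda>x::'a. norm x powr (p - 1)) \<longlongrightarrow> 0 powr (p - 1)) (at 0)"
    by (intro tendsto_powr' tendsto_norm_zero tendsto_ident_at tendsto_const) (use p in auto)
  then have "((\<lambda>x::'a. norm (power_duality p x)) \<longlongrightarrow> 0) (at 0)"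
    by (simp add: norm_power_duality[OF smooth])
  moreover have zero: "power_duality p (0::'a) = 0" by (simp add: power_duality_def)
  ultimately have "isCont (power_duality p) (0::'a)"
    by (simp add: isCont_def tendsto_norm_zero_iff zero)
  with nz show ?thesis
    by (metis continuous_at_imp_continuous_on)
qed

section \<open>Closure properties of strong measurability\<close>

lemma strongly_measurable_compose:
  assumes "continuous_on UNIV c" "strongly_measurable S f"
  shows "strongly_measurable S (\<lambda>s. c (f s))"
proof -
  obtain F where F: "\<And>i. simple_function S (F i)"
    "\<And>s. s \<in> space S \<Longrightarrow> (\<lambda>i::nat. F i s) \<longlonglongrightarrow> f s"
    using assms(2) by (auto simp: strongly_measurable_def)
  have "(\<lambda>i. c (F i s)) \<longlonglongrightarrow> c (f s)" if "s \<in> space S" for s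
    using continuous_on_tendsto_compose[OF assms(1) F(2)[OF that]] by simp
  then show ?thesis
    using simple_function_compose1[OF F(1), of c]
    unfolding strongly_measurable_def by (intro exI[of _ "\<lambda>i s. c (F i s)"]) blast
qed

lemma strongly_measurable_add:
  assumes "strongly_measurable S f" "strongly_measurable S g"
  shows "strongly_measurable S (\<lambda>s. f s + g s)"
proof -
  obtain F where F: "\<And>i. simple_function S (F i)"
    "\<And>s. s \<in> space S \<Longrightarrow> (\<lambda>i::nat. F i s) \<longlonglongrightarrow> f s"
    using assms(1) by (auto simp: strongly_measurable_def)
  obtain G where G: "\<And>i. simple_function S (G i)"
    "\<And>s. s \<in> space S \<Longrightarrow> (\<lambda>i::nat. G i s) \<longlonglongrightarrow> g s"
    using assms(2) by (auto simp: strongly_measurable_def)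
  have "simple_function S (\<lambda>s. F i s + G i s)" for i
    using simple_function_compose1[OF simple_function_Pair[OF F(1)[of i] G(1)[of i]],
        of "\<lambda>(x, y). x + y"] by simp
  then show ?thesis
    unfolding strongly_measurable_def
    by (intro exI[of _ "\<lambda>i s. F i s + G i s"]) (auto intro!: tendsto_add F G)
qed

lemma strongly_measurable_scaleR:
  "strongly_measurable S f \<Longrightarrow> strongly_measurable S (\<lambda>s. c *\<^sub>R f s)"
  by (rule strongly_measurable_compose[of "\<lambda>x. c *\<^sub>R x"]) (auto intro!: continuous_intros)

lemma strongly_measurable_diff:
  assumes "strongly_measurable S f" "strongly_measurable S g"
  shows "strongly_measurable S (\<lambda>s. f s - g s)"
  using strongly_measurable_add[OF assms(1) strongly_measurable_scaleR[OF assms(2), of "-1"]] by simp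

lemma strongly_measurable_zero: "strongly_measurable S (\<lambda>s. 0)"
  unfolding strongly_measurable_def by (intro exI[of _ "\<lambda>i s. 0"]) auto

lemma strongly_measurable_sum:
  assumes "\<And>i. i \<in> I \<Longrightarrow> strongly_measurable S (f i)"
  shows "strongly_measurable S (\<lambda>s. \<Sum>i\<in>I. f i s)"
  using assms
  by (induction I rule: infinite_finite_induct)
    (auto intro: strongly_measurable_add strongly_measurable_zero)

lemma strongly_measurable_cut_off:
  assumes "strongly_measurable S f" "A \<in> sets S"
  shows "strongly_measurable S (cut_off A f)"
proof -
  obtain F where F: "\<And>i. simple_function S (F i)"
    "\<And>s. s \<in> space S \<Longrightarrow> (\<lambda>i::nat. F i s) \<longlonglongrightarrow> f s"
    using assms(1) by (auto simp: strongly_measurable_def)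
  have "simple_function S (cut_off A (F i))" for i
    unfolding cut_off_def using assms(2) F(1) by (intro simple_function_If_set) auto
  moreover have "(\<lambda>i. cut_off A (F i) s) \<longlonglongrightarrow> cut_off A f s" if "s \<in> space S" for s
    using F(2)[OF that] by (simp add: cut_off_def)
  ultimately show ?thesis
    unfolding strongly_measurable_def by (intro exI[of _ "\<lambda>i. cut_off A (F i)"]) blast
qed

lemma strongly_measurable_norm:
  assumes "strongly_measurable S f"
  shows "(\<lambda>s. norm (f s)) \<in> borel_measurable S"
proof -
  obtain F where F: "\<And>i. simple_function S (F i)"
    "\<And>s. s \<in> space S \<Longrightarrow> (\<lambda>i::nat. F i s) \<longlonglongrightarrow> f s"
    using assms by (auto simp: strongly_measurable_def)
  show ?thesis
    by (rule borel_measurable_LIMSEQ_metric[where f = "\<lambda>i s. norm (F i s)"])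
      (rule borel_measurable_simple_function[OF simple_function_compose1[OF F(1), of norm]],
       rule tendsto_norm[OF F(2)])
qed

section \<open>Cut-offs, multiples and norms in the Bochner space\<close>

lemma norm_cut_off_powr:
  "norm (cut_off A f s) powr p = indicat_real A s * norm (f s) powr p"
  by (simp add: cut_off_def)

lemma cut_off_in_Lp:
  assumes "f \<in> Lp S p" "A \<in> sets S"
  shows "cut_off A f \<in> Lp S p"
  using assms integrable_mult_indicator[of A S "\<lambda>s. norm (f s) powr p"]
  by (auto simp: Lp_def norm_cut_off_powr intro!: strongly_measurable_cut_off)

lemma scaleR_in_Lp:
  assumes "f \<in> Lp S p"
  shows "(\<lambda>s. c *\<^sub>R f s) \<in> Lp S p"
  using assms by (auto simp: Lp_def powr_mult intro: strongly_measurable_scaleR)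

lemma Lp_norm_nonneg: "0 \<le> Lp_norm S p f"
  by (simp add: Lp_norm_def)

lemma Lp_norm_powr:
  assumes "0 < p"
  shows "Lp_norm S p f powr p = (\<integral>s. norm (f s) powr p \<partial>S)"
  using assms by (simp add: Lp_norm_def powr_powr)

lemma Lp_norm_eq_0_iff:
  assumes "0 < p" "f \<in> Lp S p"
  shows "Lp_norm S p f = 0 \<longleftrightarrow> (AE s in S. f s = 0)"
proof -
  have "Lp_norm S p f = 0 \<longleftrightarrow> (\<integral>s. norm (f s) powr p \<partial>S) = 0"
    by (simp add: Lp_norm_def)
  also have "\<dots> \<longleftrightarrow> (AE s in S. norm (f s) powr p = 0)"
    using assms(2) by (intro integral_nonneg_eq_0_iff_AE) (auto simp: Lp_def)
  finally show ?thesis by simp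
qed

section \<open>Explicit form and uniqueness of the duality mapping\<close>

text \<open>With \<open>b\<close> fixed, the gap between the two sides of Young's inequality is
  minimal at a positive \<open>a\<close> where equality holds, so its derivative
  \<open>a powr (p - 1) - b\<close> vanishes there.\<close>

lemma Youngs_inequality_eqD:
  fixes p q a b :: real
  assumes pq: "1 < p" "1 < q" "1 / p + 1 / q = 1" and ab: "0 \<le> a" "0 \<le> b"
    and eq: "a * b = a powr p / p + b powr q / q"
  shows "b = a powr (p - 1)"
proof (cases "a = 0")
  case True
  then show ?thesis using eq pq by simp
next
  case False
  \<comment> \<open>\<open>\<phi>\<close> is nonnegative on the positive reals and vanishes at \<open>a\<close>.\<close>
  define \<phi> where "\<phi> t = t powr p / p + b powr q / q - t * b" for t
  have "((\<lambda>t. t powr p) has_real_derivative p * a powr (p - 1)) (at a)"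
    using False ab by (intro has_real_derivative_powr) auto
  then have "(\<phi> has_real_derivative p * a powr (p - 1) / p + 0 - 1 * b) (at a)"
    unfolding \<phi>_def by (intro DERIV_diff DERIV_add DERIV_cdivide DERIV_const DERIV_cmult_right DERIV_ident)
  then have "(\<phi> has_real_derivative a powr (p - 1) - b) (at a)"
    using pq(1) by simp
  \<comment> \<open>The radius \<open>a\<close> keeps \<open>y\<close> positive, where Young's
    inequality applies.\<close>
  moreover have "\<phi> a \<le> \<phi> y" if "\<bar>a - y\<bar> < a" for y
    using Youngs_inequality[OF pq, of y b] that ab eq by (simp add: \<phi>_def)
  ultimately have "a powr (p - 1) - b = 0"
    using False ab by (intro DERIV_local_min[of \<phi> _ a a]) auto
  then show ?thesis by simp
qed

text \<open>The explicit candidate for the duality map. With \<open>N\<close> the norm of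
  \<open>f\<close>, the composite of \<open>power_duality p\<close> and \<open>f\<close> has norm
  \<open>N powr (p - 1)\<close>; the factor \<open>N powr (2 - p)\<close> corrects this to
  \<open>N\<close>.\<close>

definition Lp_duality :: "'s measure \<Rightarrow> real \<Rightarrow> ('s \<Rightarrow> 'a::real_normed_vector) \<Rightarrow> 's \<Rightarrow> ('a \<Rightarrow>\<^sub>L real)" where
  "Lp_duality S p f s = Lp_norm S p f powr (2 - p) *\<^sub>R power_duality p (f s)"

lemma conjugate_exponent:
  fixes p q :: real
  assumes "1 < p" "1 < q" "1 / p + 1 / q = 1"
  shows "(p - 1) * q = p"
  using assms by (simp add: field_simps)

lemma norm_power_duality_powr:
  fixes x :: "'a::real_normed_vector"
  assumes "uniformly_smooth TYPE('a)" "1 < p" "1 < q" "1 / p + 1 / q = 1"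
  shows "norm (power_duality p x) powr q = norm x powr p"
  using assms by (simp add: norm_power_duality powr_powr conjugate_exponent)

context
  fixes S :: "'s measure" and f :: "'s \<Rightarrow> 'a::real_normed_vector" and p q :: real
  assumes smooth: "uniformly_smooth TYPE('a)"
    and p: "1 < p" and q: "1 < q" and pq: "1 / p + 1 / q = 1"
    and f: "f \<in> Lp S p"
begin

lemma power_duality_in_Lp: "(\<lambda>s. power_duality p (f s)) \<in> Lp S q"
  using f strongly_measurable_compose[OF continuous_on_power_duality[OF smooth p]]
  by (auto simp: Lp_def norm_power_duality_powr[OF smooth p q pq])

lemma Lp_duality_in_Lp: "Lp_duality S p f \<in> Lp S q"
  using scaleR_in_Lp[OF power_duality_in_Lp] by (simp add: Lp_duality_def[abs_def])

lemma Lp_norm_power_duality: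
  "Lp_norm S q (\<lambda>s. power_duality p (f s)) = Lp_norm S p f powr (p - 1)"
proof -
  have "1 / q = (p - 1) / p" using pq p by (simp add: field_simps)
  then show ?thesis by (simp add: Lp_norm_def norm_power_duality_powr[OF smooth p q pq] powr_powr)
qed

lemma Lp_norm_Lp_duality: "Lp_norm S q (Lp_duality S p f) = Lp_norm S p f"
proof -
  have "Lp_norm S q (Lp_duality S p f) =
      Lp_norm S p f powr (2 - p) * Lp_norm S q (\<lambda>s. power_duality p (f s))"
    using q by (simp add: Lp_norm_def Lp_duality_def powr_mult powr_powr)
  also have "\<dots> = Lp_norm S p f powr 1"
    by (simp add: Lp_norm_power_duality flip: powr_add)
  finally show ?thesis by (simp add: Lp_norm_nonneg)
qed

lemma Lp_pairing_Lp_duality: "Lp_pairing S (Lp_duality S p f) f = (Lp_norm S p f)\<^sup>2"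
proof -
  have "Lp_pairing S (Lp_duality S p f) f = Lp_norm S p f powr (2 - p) * Lp_norm S p f powr p"
    using p by (simp add: Lp_pairing_def Lp_duality_def blinfun.bilinear_simps
        power_duality_apply[OF smooth] Lp_norm_powr)
  also have "\<dots> = Lp_norm S p f powr 2" by (simp flip: powr_add)
  finally show ?thesis by (simp add: Lp_norm_nonneg)
qed

text \<open>The normalised pointwise gap \<open>G\<close> is nonnegative with integral 0, so almost
  everywhere both Young's inequality and the operator norm bound are equalities, which determine
  \<open>g s\<close>. Hence the representative chosen in \<open>duality_map\<close> does not
  matter.\<close>

lemma Lp_duality_unique:
  assumes g: "g \<in> Lp S q" "Lp_pairing S g f = (Lp_norm S q g)\<^sup>2" "(Lp_norm S q g)\<^sup>2 = (Lp_norm S p f)\<^sup>2"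
  shows "AE s in S. g s = Lp_duality S p f s"
proof -
  define N where "N = Lp_norm S p f"
  have Ng: "Lp_norm S q g = N"
    using g(3) by (simp add: N_def Lp_norm_nonneg power2_eq_iff_nonneg)
  have N0: "0 \<le> N" by (simp add: N_def Lp_norm_nonneg)
  show ?thesis
  proof (cases "N = 0")
    case True
    then have "AE s in S. g s = 0" using Lp_norm_eq_0_iff[of q g S] Ng g(1) q by simp
    \<comment> \<open>The candidate vanishes too, because its factor \<open>0 powr (2 - p)\<close>
      is 0 for every \<open>p\<close>.\<close>
    then show ?thesis using True by (simp add: Lp_duality_def N_def)
  next
    case False
    then have N: "0 < N" using N0 by simp
    \<comment> \<open>Division by \<open>N\<close> turns both norms into 1, so the integral of
      \<open>G\<close> becomes \<open>1 / p + 1 / q - 1 = 0\<close>.\<close>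
    define G where "G s = (norm (f s) / N) powr p / p + (norm (g s) / N) powr q / q
      - blinfun_apply (g s) (f s) / N\<^sup>2" for s
    have pair: "(\<integral>s. blinfun_apply (g s) (f s) \<partial>S) = N\<^sup>2"
      using g(2) Ng by (simp add: Lp_pairing_def)
    \<comment> \<open>A non-integrable function has integral 0 by convention, whereas this integral
      is \<open>N\<^sup>2 > 0\<close>.\<close>
    then have int: "integrable S (\<lambda>s. blinfun_apply (g s) (f s))"
      using N not_integrable_integral_eq[of S "\<lambda>s. blinfun_apply (g s) (f s)"] by force
    have If: "integrable S (\<lambda>s. norm (f s) powr p)" "(\<integral>s. norm (f s) powr p \<partial>S) = N powr p"
      using f p by (auto simp: Lp_def N_def Lp_norm_powr)
    have Ig: "integrable S (\<lambda>s. norm (g s) powr q)" "(\<integral>s. norm (g s) powr q \<partial>S) = N powr q"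
      using g(1) q by (auto simp: Lp_def Ng[symmetric] Lp_norm_powr)
    have intG: "integrable S G"
      unfolding G_def using If Ig int N by (auto simp: powr_divide)
    have "integral\<^sup>L S G = N powr p / N powr p / p + N powr q / N powr q / q - N\<^sup>2 / N\<^sup>2"
      unfolding G_def using If Ig int N by (simp add: powr_divide pair)
    also have "\<dots> = 0" using N pq by simp
    finally have "integral\<^sup>L S G = 0" .
    moreover have apply_le: "blinfun_apply (g s) (f s) \<le> norm (g s) * norm (f s)" for s
      using norm_blinfun[of "g s" "f s"] by simp
    have young: "norm (f s) / N * (norm (g s) / N)
        \<le> (norm (f s) / N) powr p / p + (norm (g s) / N) powr q / q" for s
      using N by (intro Youngs_inequality p q pq) auto
    have apply_le': "blinfun_apply (g s) (f s) / N\<^sup>2 \<le> norm (f s) / N * (norm (g s) / N)" for s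
      using apply_le[of s] N by (simp add: field_simps power2_eq_square)
    have "0 \<le> G s" for s
      using young[of s] apply_le'[of s] by (simp add: G_def)
    ultimately have "AE s in S. G s = 0"
      using integral_nonneg_eq_0_iff_AE[OF intG] by simp
    then show ?thesis
    proof (eventually_elim)
      case (elim s)
      then have "norm (f s) / N * (norm (g s) / N)
          = (norm (f s) / N) powr p / p + (norm (g s) / N) powr q / q"
        and apply_eq: "blinfun_apply (g s) (f s) / N\<^sup>2 = norm (f s) / N * (norm (g s) / N)"
        using young[of s] apply_le'[of s] by (auto simp: G_def)
      then have eq: "norm (g s) / N = (norm (f s) / N) powr (p - 1)"
        using N Youngs_inequality_eqD[OF p q pq, of "norm (f s) / N" "norm (g s) / N"] by auto
      have g_eq: "blinfun_apply (g s) (f s) = norm (g s) * norm (f s)"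
        using N apply_eq by (simp add: power2_eq_square)
      define c where "c = N powr (2 - p)"
      have c: "0 < c" using N by (simp add: c_def)
      have "norm (g s) = N * (norm (f s) powr (p - 1) / N powr (p - 1))"
        using eq N by (simp add: powr_divide field_simps)
      also have "\<dots> = c * norm (f s) powr (p - 1)"
        using N by (simp add: c_def powr_diff field_simps power2_eq_square)
      finally have norm_g: "norm (g s) = c * norm (f s) powr (p - 1)" .
      have "g s /\<^sub>R c = power_duality p (f s)"
        using c g_eq norm_g
        by (intro power_duality_unique smooth) (simp_all add: blinfun.bilinear_simps)
      then have "c *\<^sub>R (g s /\<^sub>R c) = c *\<^sub>R power_duality p (f s)" by simp
      then have "g s = c *\<^sub>R power_duality p (f s)" using c by simp
      then show ?case by (simp add: Lp_duality_def c_def N_def)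
    qed
  qed
qed

lemma duality_map_in_Lp: "duality_map S p q f \<in> Lp S q"
  and duality_map_AE_eq: "AE s in S. duality_map S p q f s = Lp_duality S p f s"
proof -
  let ?P = "\<lambda>g. g \<in> Lp S q \<and> Lp_pairing S g f = (Lp_norm S q g)\<^sup>2
    \<and> (Lp_norm S q g)\<^sup>2 = (Lp_norm S p f)\<^sup>2"
  have "?P (Lp_duality S p f)"
    by (simp add: Lp_duality_in_Lp Lp_norm_Lp_duality Lp_pairing_Lp_duality)
  then have "?P (duality_map S p q f)"
    unfolding duality_map_def by (rule someI[of ?P])
  then show "duality_map S p q f \<in> Lp S q" "AE s in S. duality_map S p q f s = Lp_duality S p f s"
    using Lp_duality_unique by auto
qed

text \<open>The powers of the norm of \<open>f\<close> cancel and a purely pointwise expression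
  remains. This is why the weights in the theorem make the terms compatible with cutting
  off.\<close>

lemma scaled_duality_map_AE_eq:
  "AE s in S. Lp_norm S p f powr (p - 2) *\<^sub>R duality_map S p q f s = power_duality p (f s)"
proof (cases "Lp_norm S p f = 0")
  \<comment> \<open>Here the powers do not cancel, since \<open>0 powr r = 0\<close>, but both sides
    vanish almost everywhere. Cells on which \<open>f\<close> is null fall under this case.\<close>
  case True
  then have "AE s in S. f s = 0" using Lp_norm_eq_0_iff[of p f S] f p by simp
  then show ?thesis by eventually_elim (simp add: True power_duality_def)
next
  case False
  then have inv: "Lp_norm S p f powr (p - 2) * Lp_norm S p f powr (2 - p) = 1"
    by (simp add: Lp_norm_nonneg flip: powr_add)
  show ?thesis
    using duality_map_AE_eq by eventually_elim (simp add: Lp_duality_def inv)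
qed

end

section \<open>Summation over the partition\<close>

text \<open>Dominated convergence along the finite unions gives an ordinary series, and nonnegative
  terms make it unconditional.\<close>

lemma has_sum_integral_partition:
  fixes F :: "'s \<Rightarrow> real" and A :: "nat \<Rightarrow> 's set"
  assumes F: "integrable S F" "\<And>s. 0 \<le> F s"
    and A: "\<And>n. n \<in> M \<Longrightarrow> A n \<in> sets S" "disjoint_family_on A M" "(\<Union>n\<in>M. A n) = space S"
  shows "((\<lambda>n. \<integral>s. indicat_real (A n) s * F s \<partial>S) has_sum integral\<^sup>L S F) M"
proof -
  \<comment> \<open>Padding with empty sets makes the family indexed by all naturals, whether
    \<open>M\<close> is finite or infinite.\<close>
  define B where "B n = (if n \<in> M then A n else {})" for n
  have B: "B n \<in> sets S" for n using A(1) by (simp add: B_def)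
  have disj: "disjoint_family_on B I" for I
    using A(2) by (auto simp: B_def disjoint_family_on_def)
  have UB: "(\<Union>n. B n) = space S" using A(3) by (auto simp: B_def split: if_splits)
  have int: "integrable S (\<lambda>s. indicat_real (B n) s * F s)" for n
    using integrable_mult_indicator[OF B F(1)] by simp
  have lim: "(\<lambda>n. \<integral>s. indicat_real (\<Union>i<n. B i) s * F s \<partial>S) \<longlonglongrightarrow> integral\<^sup>L S F"
  proof (rule integral_dominated_convergence[where w = F])
    show "AE s in S. (\<lambda>n. indicat_real (\<Union>i<n. B i) s * F s) \<longlonglongrightarrow> F s"
    proof (rule AE_I2)
      fix s assume "s \<in> space S"
      then have "indicat_real (\<Union>n. B n) s = 1" using UB by simp
      moreover have "(\<lambda>n. indicat_real (\<Union>i<n. B i) s) \<longlonglongrightarrow> indicat_real (\<Union>n. B n) s"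
        by (rule LIMSEQ_indicator_UN)
      ultimately have "(\<lambda>n. indicat_real (\<Union>i<n. B i) s) \<longlonglongrightarrow> 1" by metis
      then show "(\<lambda>n. indicat_real (\<Union>i<n. B i) s * F s) \<longlonglongrightarrow> F s"
        by (auto intro: tendsto_eq_intros)
    qed
    show "AE s in S. norm (indicat_real (\<Union>i<n. B i) s * F s) \<le> F s" for n
      using F(2) by (auto simp: indicator_def)
  qed (use F B in auto)
  have "(\<integral>s. indicat_real (\<Union>i<n. B i) s * F s \<partial>S) = (\<Sum>i<n. \<integral>s. indicat_real (B i) s * F s \<partial>S)" for n
    by (simp only: indicator_UN_disjoint[OF finite_lessThan disj] sum_distrib_right
        Bochner_Integration.integral_sum[OF int])
  with lim have "(\<lambda>n. \<integral>s. indicat_real (B n) s * F s \<partial>S) sums integral\<^sup>L S F"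
    by (simp add: sums_def)
  then have "((\<lambda>n. \<integral>s. indicat_real (B n) s * F s \<partial>S) has_sum integral\<^sup>L S F) UNIV"
    by (rule sums_nonneg_imp_has_sum) (use F(2) in \<open>auto intro!: integral_nonneg_AE\<close>)
  then show ?thesis
    by (rule has_sum_cong_neutral[THEN iffD1, rotated -1]) (auto simp: B_def)
qed

theorem proposition3p6:
  fixes S :: "'s measure" and f :: "'s \<Rightarrow> 'a::banach" and p q :: real
    and M :: "nat set" and A :: "nat \<Rightarrow> 's set"
  assumes "uniformly_convex TYPE('a)" and "uniformly_smooth TYPE('a)"
    and "1 < p" and "1 < q" and "1 / p + 1 / q = 1"
    and "strong_partition S M A"
    and "f \<in> Lp S p" and "\<not> (AE s in S. f s = 0)"
  shows "\<exists>h. Lp_has_sum S q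
           (\<lambda>n s. Lp_norm S p (cut_off (A n) f) powr (p - 2) *\<^sub>R duality_map S p q (cut_off (A n) f) s) M h
         \<and> (AE s in S. duality_map S p q f s = (1 / Lp_norm S p f powr (p - 2)) *\<^sub>R h s)"
proof -
  note smooth = assms(2) and p = assms(3) and q = assms(4) and pq = assms(5) and f = assms(7)
  have A: "A n \<in> sets S" if "n \<in> M" for n using assms(6) that by (auto simp: strong_partition_def)
  have disj: "disjoint_family_on A M" and UA: "(\<Union>n\<in>M. A n) = space S"
    using assms(6) by (auto simp: strong_partition_def)
  define T where
    "T n s = Lp_norm S p (cut_off (A n) f) powr (p - 2) *\<^sub>R duality_map S p q (cut_off (A n) f) s" for n s
  \<comment> \<open>With this choice the second conjunct is mere cancellation of a factor; the
    content lies in the convergence of the series to \<open>h\<close>.\<close>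
  define h where "h s = Lp_norm S p f powr (p - 2) *\<^sub>R duality_map S p q f s" for s
  have cut: "cut_off (A n) f \<in> Lp S p" if "n \<in> M" for n
    by (rule cut_off_in_Lp[OF f A[OF that]])
  have T: "T n \<in> Lp S q" if "n \<in> M" for n
    unfolding T_def by (intro scaleR_in_Lp duality_map_in_Lp smooth p q pq cut that)
  have h: "h \<in> Lp S q"
    unfolding h_def by (intro scaleR_in_Lp duality_map_in_Lp smooth p q pq f)
  have T_AE: "AE s in S. T n s = power_duality p (cut_off (A n) f s)" if "n \<in> M" for n
    unfolding T_def by (intro scaled_duality_map_AE_eq smooth p q pq cut that)
  have h_AE: "AE s in S. h s = power_duality p (f s)"
    unfolding h_def by (intro scaled_duality_map_AE_eq smooth p q pq f)
  define I where "I n = (\<integral>s. indicat_real (A n) s * norm (f s) powr p \<partial>S)" for n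
  define I0 where "I0 = (\<integral>s. norm (f s) powr p \<partial>S)"
  have int: "integrable S (\<lambda>s. norm (f s) powr p)" using f by (simp add: Lp_def)
  have intA: "integrable S (\<lambda>s. indicat_real (A n) s * norm (f s) powr p)" if "n \<in> M" for n
    using integrable_mult_indicator[OF A[OF that] int] by simp
  have sum_I: "(I has_sum I0) M"
    unfolding I_def I0_def by (rule has_sum_integral_partition[OF int _ A disj UA]) auto
  have tail: "Lp_norm S q (\<lambda>s. (\<Sum>n\<in>J. T n s) - h s) = (I0 - (\<Sum>n\<in>J. I n)) powr (1 / q)"
    if J: "finite J" "J \<subseteq> M" for J
  proof -
    have "AE s in S. \<forall>n\<in>J. T n s = power_duality p (cut_off (A n) f s)"
      using J T_AE by (intro AE_finite_allI) auto
    with h_AE have AE: "AE s in S. norm ((\<Sum>n\<in>J. T n s) - h s) powr q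
        = norm (f s) powr p - (\<Sum>n\<in>J. indicat_real (A n) s * norm (f s) powr p)"
    proof eventually_elim
      case (elim s)
      have "T n s = indicat_real (A n) s *\<^sub>R power_duality p (f s)" if "n \<in> J" for n
        using elim(2) that by (auto simp: cut_off_def power_duality_def)
      then have "(\<Sum>n\<in>J. T n s) = (\<Sum>n\<in>J. indicat_real (A n) s) *\<^sub>R power_duality p (f s)"
        by (simp add: scaleR_sum_left)
      \<comment> \<open>By disjointness the sum of indicators is 0 or 1, so the remainder at
        \<open>s\<close> is either 0 or \<open>- power_duality p (f s)\<close>.\<close>
      moreover have ind: "(\<Sum>n\<in>J. indicat_real (A n) s) = indicator (\<Union>n\<in>J. A n) s"
        by (rule indicator_UN_disjoint[OF J(1) disjoint_family_on_mono[OF J(2) disj], symmetric])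
      ultimately show ?case
        using elim(1) norm_power_duality_powr[OF smooth p q pq, of "f s"]
        by (simp add: indicator_def flip: sum_distrib_right)
    qed
    have meas: "strongly_measurable S (\<lambda>s. (\<Sum>n\<in>J. T n s) - h s)"
      using T h J by (intro strongly_measurable_diff strongly_measurable_sum) (auto simp: Lp_def)
    have "(\<integral>s. norm ((\<Sum>n\<in>J. T n s) - h s) powr q \<partial>S)
        = (\<integral>s. norm (f s) powr p - (\<Sum>n\<in>J. indicat_real (A n) s * norm (f s) powr p) \<partial>S)"
      using strongly_measurable_norm[OF meas] int intA J(2)
      by (intro integral_cong_AE AE) (auto intro!: borel_measurable_diff borel_measurable_sum)
    also have "\<dots> = I0 - (\<Sum>n\<in>J. I n)"
      using int intA J(2) by (subst Bochner_Integration.integral_diff)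
        (auto simp: I0_def I_def subset_iff Bochner_Integration.integral_sum)
    finally show ?thesis by (simp add: Lp_norm_def)
  qed
  have I_nonneg: "0 \<le> I n" for n by (auto simp: I_def intro!: integral_nonneg_AE)
  have "((\<lambda>J. I0 - sum I J) \<longlongrightarrow> 0) (finite_subsets_at_top M)"
    using tendsto_diff[OF tendsto_const sum_I[unfolded has_sum_def], of I0] by simp
  \<comment> \<open>Since the limit is 0, passing it through \<open>powr\<close> requires the base
    to be eventually nonnegative.\<close>
  moreover have "\<forall>\<^sub>F J in finite_subsets_at_top M. 0 \<le> I0 - sum I J"
    by (intro eventually_finite_subsets_at_top_weakI)
      (use sum_I I_nonneg in \<open>auto intro: has_sum_mono_neutral[OF has_sum_finite]\<close>)
  ultimately have "((\<lambda>J. (I0 - sum I J) powr (1 / q)) \<longlongrightarrow> 0 powr (1 / q)) (finite_subsets_at_top M)"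
    using q by (intro tendsto_powr' tendsto_const) auto
  then have "((\<lambda>J. Lp_norm S q (\<lambda>s. (\<Sum>n\<in>J. T n s) - h s)) \<longlongrightarrow> 0) (finite_subsets_at_top M)"
    using q by (subst tendsto_cong[where g = "\<lambda>J. (I0 - sum I J) powr (1 / q)"])
      (auto intro!: eventually_finite_subsets_at_top_weakI simp: tail)
  then have "Lp_has_sum S q T M h"
    using T h by (simp add: Lp_has_sum_def)
  \<comment> \<open>Here \<open>f\<close> being nonzero enters: the weight in \<open>h\<close> is
    then nonzero and can be divided out.\<close>
  moreover have "Lp_norm S p f \<noteq> 0"
    using assms(8) Lp_norm_eq_0_iff[of p f S] f p by simp
  then have "AE s in S. duality_map S p q f s = (1 / Lp_norm S p f powr (p - 2)) *\<^sub>R h s"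
    by (simp add: h_def)
  ultimately show ?thesis unfolding T_def by blast
qed

end
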